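(* Let $a,b\colon\mathbb{N}\to(0,1]$ be functions for which there exist $c,p,n_0>0$ such that $a(n)\ge c\,n^{-p}$ and $b(n)\ge c\,n^{-p}$ for all $n>n_0$. Then the open sets $N_a:=\bigcup_{n\in\mathbb{N}}(n,n+a(n))$ and $N_b:=\bigcup_{n\in\mathbb{N}}(n,n+b(n))$ in $\mathbb{R}$ are Schwartz equivalent.
   Context: $\mathbb{N}=\{1,2,3,\dots\}$. $\mathcal{S}(\mathbb{R}^n)$ is the usual Fréchet space of real-valued Schwartz functions on $\mathbb{R}^n$. For an open $U\subset\mathbb{R}^n$, $\mathcal{S}(U)$ is the closed subspace of those $f\in\mathcal{S}(\mathbb{R}^n)$ such that $f$ and all its partial derivatives vanish at every point of $\mathbb{R}^n\setminus U$, with the induced Fréchet topology; its elements are regarded (by restriction) as smooth functions on $U$. Two open subsets $U,V\subset\mathbb{R}^n$ are called Schwartz equivalent if there exists a $C^\infty$-diffeomorphism $\phi\colon U\to V$ such that $s\mapsto s\circ\phi$ is an isomorphism of Fréchet spaces $\mathcal{S}(V)\to\mathcal{S}(U)$. *)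

theory Defs
  imports "HOL-Analysis.Analysis"
begin

text \<open>Euclidean space \<open>\<real>\<^sup>n\<close> is a type of class \<open>euclidean_space\<close>; a multi-index is a list of
  basis vectors, so \<open>iter_partial [b\<^sub>1, \<dots>, b\<^sub>k]\<close> is \<open>\<partial>\<^sub>b\<^sub>1 \<dots> \<partial>\<^sub>b\<^sub>k\<close>.\<close>

definition partial_deriv ::
    "'a::euclidean_space \<Rightarrow> ('a \<Rightarrow> 'b::real_normed_vector) \<Rightarrow> 'a \<Rightarrow> 'b" where
  "partial_deriv b f = (\<lambda>x. frechet_derivative f (at x) b)"

fun iter_partial ::
    "'a::euclidean_space list \<Rightarrow> ('a \<Rightarrow> 'b::real_normed_vector) \<Rightarrow> 'a \<Rightarrow> 'b" where
  "iter_partial [] f = f"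
| "iter_partial (b # bs) f = partial_deriv b (iter_partial bs f)"

text \<open>For open \<open>U\<close> only: \<open>C\<^sup>\<infinity>\<close> on \<open>U\<close>, independently of the values outside \<open>U\<close>.
  Differentiability of all iterated partial derivatives includes their continuity.\<close>

definition smooth_on ::
    "'a::euclidean_space set \<Rightarrow> ('a \<Rightarrow> 'b::real_normed_vector) \<Rightarrow> bool" where
  "smooth_on U f \<longleftrightarrow>
     (\<forall>bs\<in>lists Basis. \<forall>x\<in>U. iter_partial bs f differentiable (at x))"

definition diffeomorphism ::
    "'a::euclidean_space set \<Rightarrow> 'b::euclidean_space set \<Rightarrow> ('a \<Rightarrow> 'b) \<Rightarrow> bool" where
  "diffeomorphism U V \<phi> \<longleftrightarrow>
     bij_betw \<phi> U V \<and> smooth_on U \<phi> \<and> smooth_on V (inv_into U \<phi>)"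

definition schwartz_space :: "('a::euclidean_space \<Rightarrow> real) set" where
  "schwartz_space = {f. smooth_on UNIV f \<and>
     (\<forall>k. \<forall>bs\<in>lists Basis. bounded (range (\<lambda>x. (1 + norm x) ^ k * iter_partial bs f x)))}"

definition schwartz_seminorm ::
    "nat \<Rightarrow> 'a::euclidean_space list \<Rightarrow> ('a \<Rightarrow> real) \<Rightarrow> real" where
  "schwartz_seminorm k bs f = (SUP x. (1 + norm x) ^ k * \<bar>iter_partial bs f x\<bar>)"

definition schwartz_topology :: "('a::euclidean_space \<Rightarrow> real) topology" where
  "schwartz_topology = topology_generated_by
     {{g \<in> schwartz_space. schwartz_seminorm k bs (\<lambda>x. g x - f x) < e} | f k bs e.
        f \<in> schwartz_space \<and> bs \<in> lists Basis \<and> 0 < e}"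

definition schwartz_space_on :: "'a::euclidean_space set \<Rightarrow> ('a \<Rightarrow> real) set" where
  "schwartz_space_on U =
     {f \<in> schwartz_space. \<forall>bs\<in>lists Basis. \<forall>x\<in>- U. iter_partial bs f x = 0}"

definition schwartz_topology_on :: "'a::euclidean_space set \<Rightarrow> ('a \<Rightarrow> real) topology" where
  "schwartz_topology_on U = subtopology schwartz_topology (schwartz_space_on U)"

text \<open>Elements of \<open>schwartz_space_on U\<close> are functions on the whole space that vanish off \<open>U\<close>, so
  \<open>s \<circ> \<phi>\<close>, which is a function on \<open>U\<close>, has to be extended by zero.\<close>

definition pullback_on ::
    "'a::euclidean_space set \<Rightarrow> ('a \<Rightarrow> 'b) \<Rightarrow> ('b \<Rightarrow> real) \<Rightarrow> 'a \<Rightarrow> real" where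
  "pullback_on U \<phi> s = (\<lambda>x. if x \<in> U then s (\<phi> x) else 0)"

definition schwartz_isomorphism ::
    "'a::euclidean_space set \<Rightarrow> 'b::euclidean_space set \<Rightarrow>
     (('a \<Rightarrow> real) \<Rightarrow> ('b \<Rightarrow> real)) \<Rightarrow> bool" where
  "schwartz_isomorphism V U T \<longleftrightarrow>
     (\<forall>f\<in>schwartz_space_on V. \<forall>g\<in>schwartz_space_on V. \<forall>\<alpha> \<beta>.
        T (\<lambda>x. \<alpha> * f x + \<beta> * g x) = (\<lambda>x. \<alpha> * T f x + \<beta> * T g x)) \<and>
     homeomorphic_map (schwartz_topology_on V) (schwartz_topology_on U) T"

definition schwartz_equivalent :: "'a::euclidean_space set \<Rightarrow> 'a set \<Rightarrow> bool" where
  "schwartz_equivalent U V \<longleftrightarrow> open U \<and> open V \<and>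
     (\<exists>\<phi>. diffeomorphism U V \<phi> \<and> schwartz_isomorphism V U (pullback_on U \<phi>))"

definition interval_union :: "(nat \<Rightarrow> real) \<Rightarrow> real set" where
  "interval_union a = (\<Union>n\<in>{1..}. {real n <..< real n + a n})"

end

theory Submission
  imports Defs
begin

text \<open>Map each interval \<open>(n, n + a n)\<close> affinely onto \<open>(n, n + b n)\<close>. Pulling back multiplies the
  \<open>k\<close>-th derivative on the \<open>n\<close>-th interval by \<open>(b n / a n) ^ k\<close>, which grows at most polynomially
  in \<open>n\<close> and is therefore absorbed by the rapid decay of Schwartz functions. The extension by zero
  stays smooth because a function all of whose derivatives vanish at an endpoint \<open>e\<close> is bounded by
  a multiple of \<open>\<bar>y - e\<bar>\<^sup>2\<close>.\<close>

section \<open>Iterated derivatives on the real line\<close>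

text \<open>The basis of the real line is the single vector 1, so a multi-index is just an order
  \<open>k\<close>, written \<open>replicate k 1\<close>. This turns quantifiers over multi-indices
  into quantifiers over \<open>k\<close>.\<close>

lemma lists_singleton: "lists {x} = range (\<lambda>k. replicate k x)"
proof -
  have "bs = replicate (length bs) x" if "bs \<in> lists {x}" for bs
    using that by (intro replicate_eqI) auto
  then show ?thesis
    by auto
qed

lemma partial_deriv_one_eq:
  fixes f :: "real \<Rightarrow> real"
  assumes "(f has_real_derivative D) (at x)"
  shows "partial_deriv 1 f x = D"
proof -
  have "frechet_derivative f (at x) = (*) D"
    using assms by (metis frechet_derivative_at has_field_derivative_def)
  then show ?thesis
    by (simp add: partial_deriv_def)
qed

lemma has_real_derivative_cong_open:
  fixes f g :: "real \<Rightarrow> real"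
  assumes "open U" "x \<in> U" "\<And>y. y \<in> U \<Longrightarrow> f y = g y" "(g has_real_derivative D) (at x)"
  shows "(f has_real_derivative D) (at x)"
  using has_field_derivative_transform_within_open[OF assms(4,1,2)] assms(3) by simp

text \<open>A way around computing \<open>frechet_derivative\<close>: once a candidate
  \<open>F\<close> for all derivatives is guessed, one first-order check per \<open>k\<close> gives
  both the iterated derivatives and smoothness. Openness of \<open>U\<close> matters because
  \<open>f\<close> is only known on \<open>U\<close>.\<close>

lemma derivative_sequence:
  fixes f :: "real \<Rightarrow> real" and F :: "nat \<Rightarrow> real \<Rightarrow> real"
  assumes "open U"
    and F0: "\<And>x. x \<in> U \<Longrightarrow> f x = F 0 x"
    and FS: "\<And>k x. x \<in> U \<Longrightarrow> (F k has_real_derivative F (Suc k) x) (at x)"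
  shows iter_partial_eq_sequence: "x \<in> U \<Longrightarrow> iter_partial (replicate k 1) f x = F k x"
    and smooth_on_if_sequence: "smooth_on U f"
proof -
  have eq: "\<forall>x\<in>U. iter_partial (replicate k 1) f x = F k x" for k
  proof (induction k)
    case (Suc k)
    \<comment> \<open>By the induction hypothesis the \<open>k\<close>-th derivative agrees with
      \<open>F k\<close> on all of the open set \<open>U\<close>, so it inherits the derivative of
      \<open>F k\<close> at \<open>x\<close>.\<close>
    have "(iter_partial (replicate k 1) f has_real_derivative F (Suc k) x) (at x)" if "x \<in> U" for x
      using has_real_derivative_cong_open[OF \<open>open U\<close> that _ FS[OF that, of k]] Suc by blast
    then show ?case
      by (simp add: partial_deriv_one_eq)
  qed (simp add: F0)
  then show "x \<in> U \<Longrightarrow> iter_partial (replicate k 1) f x = F k x"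
    by blast
  have "iter_partial (replicate k 1) f differentiable (at x)" if "x \<in> U" for k x
    using has_real_derivative_cong_open[OF \<open>open U\<close> that _ FS[OF that, of k]] eq
    by (meson real_differentiable_def)
  then show "smooth_on U f"
    by (auto simp: smooth_on_def lists_singleton)
qed

lemma smooth_has_iter_partial_derivative:
  fixes f :: "real \<Rightarrow> real"
  assumes "smooth_on U f" "x \<in> U"
  shows "(iter_partial (replicate k 1) f has_real_derivative
           iter_partial (replicate (Suc k) 1) f x) (at x)"
proof -
  have "iter_partial (replicate k 1) f differentiable (at x)"
    using assms by (auto simp: smooth_on_def lists_singleton)
  then obtain D where "(iter_partial (replicate k 1) f has_real_derivative D) (at x)"
    by (meson real_differentiable_def)
  then show ?thesis
    by (simp add: partial_deriv_one_eq)
qed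

lemma smooth_iter_partial_linear:
  fixes f g :: "real \<Rightarrow> real"
  assumes "smooth_on UNIV f" "smooth_on UNIV g"
  shows "iter_partial (replicate k 1) (\<lambda>x. \<alpha> * f x + \<beta> * g x) x =
           \<alpha> * iter_partial (replicate k 1) f x + \<beta> * iter_partial (replicate k 1) g x"
    and "smooth_on UNIV (\<lambda>x. \<alpha> * f x + \<beta> * g x)"
proof -
  let ?F = "\<lambda>k x. \<alpha> * iter_partial (replicate k 1) f x + \<beta> * iter_partial (replicate k 1) g x"
  have *: "(?F k has_real_derivative ?F (Suc k) x) (at x)" for k x
    by (intro DERIV_add DERIV_cmult smooth_has_iter_partial_derivative[OF assms(1) UNIV_I]
        smooth_has_iter_partial_derivative[OF assms(2) UNIV_I])
  show "iter_partial (replicate k 1) (\<lambda>x. \<alpha> * f x + \<beta> * g x) x = ?F k x"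
    by (rule iter_partial_eq_sequence[where U = UNIV]) (auto intro: *[simplified])
  show "smooth_on UNIV (\<lambda>x. \<alpha> * f x + \<beta> * g x)"
    by (rule smooth_on_if_sequence[where F = ?F]) (auto intro: *[simplified])
qed

section \<open>Schwartz functions on the real line\<close>

lemma schwartz_space_real_iff:
  fixes f :: "real \<Rightarrow> real"
  shows "f \<in> schwartz_space \<longleftrightarrow> smooth_on UNIV f \<and>
    (\<forall>m k. \<exists>C. \<forall>x. (1 + \<bar>x\<bar>) ^ m * \<bar>iter_partial (replicate k 1) f x\<bar> \<le> C)"
  by (auto simp: schwartz_space_def lists_singleton bounded_iff abs_mult)

lemma schwartz_space_linear:
  fixes f g :: "real \<Rightarrow> real"
  assumes f: "f \<in> schwartz_space" and g: "g \<in> schwartz_space"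
  shows "(\<lambda>x. \<alpha> * f x + \<beta> * g x) \<in> schwartz_space"
proof -
  have sm: "smooth_on UNIV f" "smooth_on UNIV g"
    using f g by (auto simp: schwartz_space_real_iff)
  have "\<exists>C. \<forall>x. (1 + \<bar>x\<bar>) ^ m * \<bar>iter_partial (replicate k 1) (\<lambda>x. \<alpha> * f x + \<beta> * g x) x\<bar> \<le> C"
    for m k
  proof -
    obtain A where A: "\<And>x. (1 + \<bar>x\<bar>) ^ m * \<bar>iter_partial (replicate k 1) f x\<bar> \<le> A"
      using f unfolding schwartz_space_real_iff by metis
    obtain B where B: "\<And>x. (1 + \<bar>x\<bar>) ^ m * \<bar>iter_partial (replicate k 1) g x\<bar> \<le> B"
      using g unfolding schwartz_space_real_iff by metis
    have "(1 + \<bar>x\<bar>) ^ m * \<bar>iter_partial (replicate k 1) (\<lambda>x. \<alpha> * f x + \<beta> * g x) x\<bar>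
        \<le> \<bar>\<alpha>\<bar> * A + \<bar>\<beta>\<bar> * B" for x
    proof -
      let ?u = "iter_partial (replicate k 1) f x" and ?v = "iter_partial (replicate k 1) g x"
      have "(1 + \<bar>x\<bar>) ^ m * \<bar>\<alpha> * ?u + \<beta> * ?v\<bar> \<le> (1 + \<bar>x\<bar>) ^ m * (\<bar>\<alpha>\<bar> * \<bar>?u\<bar> + \<bar>\<beta>\<bar> * \<bar>?v\<bar>)"
        by (intro mult_left_mono) (simp_all add: abs_mult[symmetric])
      also have "\<dots> = \<bar>\<alpha>\<bar> * ((1 + \<bar>x\<bar>) ^ m * \<bar>?u\<bar>) + \<bar>\<beta>\<bar> * ((1 + \<bar>x\<bar>) ^ m * \<bar>?v\<bar>)"
        by (simp add: algebra_simps)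
      also have "\<dots> \<le> \<bar>\<alpha>\<bar> * A + \<bar>\<beta>\<bar> * B"
        by (intro add_mono mult_left_mono A B) auto
      finally show ?thesis
        by (simp add: smooth_iter_partial_linear(1)[OF sm])
    qed
    then show ?thesis
      by blast
  qed
  then show ?thesis
    using smooth_iter_partial_linear(2)[OF sm] by (simp add: schwartz_space_real_iff)
qed

text \<open>A \<open>SUP\<close> of reals is informative only for a set bounded above; membership in
  \<open>schwartz_space\<close> supplies that bound.\<close>

lemma schwartz_seminorm_upper:
  fixes f :: "real \<Rightarrow> real"
  assumes "f \<in> schwartz_space"
  shows "(1 + \<bar>x\<bar>) ^ m * \<bar>iter_partial (replicate k 1) f x\<bar> \<le> schwartz_seminorm m (replicate k 1) f"
proof -
  have "bdd_above (range (\<lambda>x. (1 + norm x) ^ m * \<bar>iter_partial (replicate k 1) f x\<bar>))"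
    using assms unfolding schwartz_space_real_iff by (auto simp: bdd_above_def)
  then show ?thesis
    using cSUP_upper[of x UNIV "\<lambda>x. (1 + norm x) ^ m * \<bar>iter_partial (replicate k 1) f x\<bar>"]
    by (simp add: schwartz_seminorm_def)
qed

lemma schwartz_seminorm_least:
  fixes f :: "real \<Rightarrow> real"
  assumes "\<And>x. (1 + \<bar>x\<bar>) ^ m * \<bar>iter_partial (replicate k 1) f x\<bar> \<le> C"
  shows "schwartz_seminorm m (replicate k 1) f \<le> C"
  unfolding schwartz_seminorm_def using assms by (intro cSUP_least) auto

text \<open>This places each Schwartz function in every seminorm ball centred at itself, which gives
  the \<open>topspace\<close> and the neighbourhoods in the continuity criterion.\<close>

lemma schwartz_seminorm_diff_self:
  fixes f :: "real \<Rightarrow> real"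
  assumes "f \<in> schwartz_space"
  shows "schwartz_seminorm m (replicate k 1) (\<lambda>x. f x - f x) = 0"
proof -
  have "iter_partial (replicate k 1) (\<lambda>x::real. 0::real) x = 0" for x
    using iter_partial_eq_sequence[of UNIV "\<lambda>x. 0" "\<lambda>k x. 0"] by simp
  then show ?thesis
    by (simp add: schwartz_seminorm_def)
qed

lemma schwartz_space_diff:
  fixes f g :: "real \<Rightarrow> real"
  assumes "f \<in> schwartz_space" "g \<in> schwartz_space"
  shows "(\<lambda>x. f x - g x) \<in> schwartz_space"
  using schwartz_space_linear[OF assms, of 1 "-1"] by simp

lemma schwartz_seminorm_diff_triangle:
  fixes f g h :: "real \<Rightarrow> real"
  assumes "f \<in> schwartz_space" "g \<in> schwartz_space" "h \<in> schwartz_space"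
  shows "schwartz_seminorm m (replicate k 1) (\<lambda>x. f x - h x) \<le>
    schwartz_seminorm m (replicate k 1) (\<lambda>x. f x - g x) +
    schwartz_seminorm m (replicate k 1) (\<lambda>x. g x - h x)"
proof (rule schwartz_seminorm_least)
  fix x :: real
  let ?D = "iter_partial (replicate k 1)"
  have sm: "smooth_on UNIV (\<lambda>x. f x - g x)" "smooth_on UNIV (\<lambda>x. g x - h x)"
    using assms schwartz_space_diff schwartz_space_real_iff by blast+
  have "?D (\<lambda>x. f x - h x) x = ?D (\<lambda>x. f x - g x) x + ?D (\<lambda>x. g x - h x) x"
    using smooth_iter_partial_linear(1)[OF sm, where \<alpha> = 1 and \<beta> = 1] by simp
  then have "(1 + \<bar>x\<bar>) ^ m * \<bar>?D (\<lambda>x. f x - h x) x\<bar> \<le>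
      (1 + \<bar>x\<bar>) ^ m * (\<bar>?D (\<lambda>x. f x - g x) x\<bar> + \<bar>?D (\<lambda>x. g x - h x) x\<bar>)"
    by (intro mult_left_mono) auto
  also have "\<dots> = (1 + \<bar>x\<bar>) ^ m * \<bar>?D (\<lambda>x. f x - g x) x\<bar> +
      (1 + \<bar>x\<bar>) ^ m * \<bar>?D (\<lambda>x. g x - h x) x\<bar>"
    by (simp add: algebra_simps)
  also have "\<dots> \<le> schwartz_seminorm m (replicate k 1) (\<lambda>x. f x - g x) +
      schwartz_seminorm m (replicate k 1) (\<lambda>x. g x - h x)"
    using assms by (intro add_mono schwartz_seminorm_upper schwartz_space_diff)
  finally show "(1 + \<bar>x\<bar>) ^ m * \<bar>?D (\<lambda>x. f x - h x) x\<bar> \<le>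
    schwartz_seminorm m (replicate k 1) (\<lambda>x. f x - g x) +
    schwartz_seminorm m (replicate k 1) (\<lambda>x. g x - h x)" .
qed

lemma schwartz_space_on_real_iff:
  fixes f :: "real \<Rightarrow> real"
  shows "f \<in> schwartz_space_on U \<longleftrightarrow>
    f \<in> schwartz_space \<and> (\<forall>k. \<forall>x. x \<notin> U \<longrightarrow> iter_partial (replicate k 1) f x = 0)"
  by (auto simp: schwartz_space_on_def lists_singleton)

section \<open>The topology generated by seminorm balls, and a continuity criterion\<close>

lemma topspace_schwartz_topology: "topspace schwartz_topology = (schwartz_space :: (real \<Rightarrow> real) set)"
proof -
  have "f \<in> \<Union> {{g \<in> schwartz_space. schwartz_seminorm k bs (\<lambda>x. g x - f x) < e} | f k bs e.
        f \<in> schwartz_space \<and> bs \<in> lists Basis \<and> 0 < e}" if "f \<in> schwartz_space"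
    for f :: "real \<Rightarrow> real"
  proof (intro UnionI CollectI exI conjI)
    show "f \<in> {g \<in> schwartz_space. schwartz_seminorm 0 [] (\<lambda>x. g x - f x) < 1}"
      using that schwartz_seminorm_diff_self[OF that, of 0 0] by simp
  qed (use that in auto)
  then show ?thesis
    unfolding schwartz_topology_def topology_generated_by_topspace by blast
qed

lemma topspace_schwartz_topology_on:
  "topspace (schwartz_topology_on U) = (schwartz_space_on U :: (real \<Rightarrow> real) set)"
  unfolding schwartz_topology_on_def topspace_subtopology topspace_schwartz_topology
  by (auto simp: schwartz_space_on_def)

lemma openin_schwartz_ball:
  fixes f :: "real \<Rightarrow> real"
  assumes "f \<in> schwartz_space" "0 < e"
  shows "openin (schwartz_topology_on U)
    {g \<in> schwartz_space_on U. schwartz_seminorm m (replicate k 1) (\<lambda>x. g x - f x) < e}"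
proof -
  have "openin schwartz_topology
    {g \<in> schwartz_space. schwartz_seminorm m (replicate k 1) (\<lambda>x. g x - f x) < e}"
    unfolding schwartz_topology_def using assms
    by (intro topology_generated_by_Basis CollectI exI[of _ f] exI[of _ m] exI[of _ "replicate k 1"]
        exI[of _ e]) (auto simp: lists_singleton)
  moreover have "{g \<in> schwartz_space_on U. schwartz_seminorm m (replicate k 1) (\<lambda>x. g x - f x) < e} =
      {g \<in> schwartz_space. schwartz_seminorm m (replicate k 1) (\<lambda>x. g x - f x) < e}
        \<inter> schwartz_space_on U"
    by (auto simp: schwartz_space_on_def)
  ultimately show ?thesis
    unfolding schwartz_topology_on_def by (simp add: openin_subtopology_Int)
qed

text \<open>Preimages need to be checked only for the generating balls, and each target seminorm is
  controlled by a single source seminorm. Estimating differences \<open>T f - T g\<close> makes the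
  criterion a Lipschitz condition, so linearity of \<open>T\<close> does not enter.\<close>

lemma continuous_map_schwartz:
  fixes T :: "(real \<Rightarrow> real) \<Rightarrow> real \<Rightarrow> real"
  assumes maps: "\<And>f. f \<in> schwartz_space_on V \<Longrightarrow> T f \<in> schwartz_space_on U"
    and bound: "\<And>m k. \<exists>C>0. \<exists>m' k'. \<forall>f\<in>schwartz_space_on V. \<forall>g\<in>schwartz_space_on V.
      schwartz_seminorm m (replicate k 1) (\<lambda>x. T f x - T g x) \<le>
        C * schwartz_seminorm m' (replicate k' 1) (\<lambda>x. f x - g x)"
  shows "continuous_map (schwartz_topology_on V) (schwartz_topology_on U) T"
proof -
  have "continuous_map (schwartz_topology_on V) schwartz_topology T"
    unfolding schwartz_topology_def
  proof (rule continuous_on_generated_topo)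
    fix W :: "(real \<Rightarrow> real) set"
    assume "W \<in> {{g \<in> schwartz_space. schwartz_seminorm k bs (\<lambda>x. g x - f x) < e} | f k bs e.
        f \<in> schwartz_space \<and> bs \<in> lists Basis \<and> 0 < e}"
    then obtain f m k e where W: "f \<in> schwartz_space" "0 < e"
        "W = {g \<in> schwartz_space. schwartz_seminorm m (replicate k 1) (\<lambda>x. g x - f x) < e}"
      by (auto simp: lists_singleton)
    obtain C m' k' where C: "C > 0" "\<And>f g. f \<in> schwartz_space_on V \<Longrightarrow> g \<in> schwartz_space_on V \<Longrightarrow>
      schwartz_seminorm m (replicate k 1) (\<lambda>x. T f x - T g x) \<le>
        C * schwartz_seminorm m' (replicate k' 1) (\<lambda>x. f x - g x)"
      using bound[of m k] by metis
    have S: "T g \<in> schwartz_space" if "g \<in> schwartz_space_on V" for g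
      using maps[OF that] by (simp add: schwartz_space_on_def)
    show "openin (schwartz_topology_on V) (T -` W \<inter> topspace (schwartz_topology_on V))"
    proof (subst openin_subopen, intro ballI)
      fix s assume s: "s \<in> T -` W \<inter> topspace (schwartz_topology_on V)"
      then have sV: "s \<in> schwartz_space_on V"
        by (simp add: topspace_schwartz_topology_on)
      then have sS: "s \<in> schwartz_space"
        by (simp add: schwartz_space_on_def)
      \<comment> \<open>The room left between \<open>T s\<close> and the boundary of the ball
        \<open>W\<close>. A source ball of radius \<open>\<delta> / C\<close> around
        \<open>s\<close> moves \<open>T s\<close> by less than this, so the triangle inequality
        keeps the image in \<open>W\<close>.\<close>
      define \<delta> where "\<delta> = e - schwartz_seminorm m (replicate k 1) (\<lambda>x. T s x - f x)"
      have "\<delta> > 0"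
        using s W by (simp add: \<delta>_def)
      let ?B = "{g \<in> schwartz_space_on V.
        schwartz_seminorm m' (replicate k' 1) (\<lambda>x. g x - s x) < \<delta> / C}"
      have "openin (schwartz_topology_on V) ?B"
        using openin_schwartz_ball[OF sS, of "\<delta> / C"] \<open>\<delta> > 0\<close> C by simp
      moreover have "s \<in> ?B"
        using sV schwartz_seminorm_diff_self[OF sS] \<open>\<delta> > 0\<close> C by simp
      moreover have "T g \<in> W" if g: "g \<in> ?B" for g
      proof -
        have gV: "g \<in> schwartz_space_on V"
          using g by simp
        have "schwartz_seminorm m (replicate k 1) (\<lambda>x. T g x - f x) \<le>
            schwartz_seminorm m (replicate k 1) (\<lambda>x. T g x - T s x) +
            schwartz_seminorm m (replicate k 1) (\<lambda>x. T s x - f x)"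
          by (intro schwartz_seminorm_diff_triangle S gV sV W)
        moreover have "C * schwartz_seminorm m' (replicate k' 1) (\<lambda>x. g x - s x) < \<delta>"
          using g C(1) by (simp add: field_simps)
        ultimately have "schwartz_seminorm m (replicate k 1) (\<lambda>x. T g x - f x) < e"
          using C(2)[OF gV sV] unfolding \<delta>_def by linarith
        then show ?thesis
          using S[OF gV] W by simp
      qed
      ultimately show "\<exists>B. openin (schwartz_topology_on V) B \<and> s \<in> B \<and>
          B \<subseteq> T -` W \<inter> topspace (schwartz_topology_on V)"
        by (intro exI[of _ ?B]) (auto simp: topspace_schwartz_topology_on)
    qed
  next
    have "T ` topspace (schwartz_topology_on V) \<subseteq> topspace schwartz_topology"
      using maps by (auto simp: topspace_schwartz_topology_on topspace_schwartz_topology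
          schwartz_space_on_def)
    then show "T ` topspace (schwartz_topology_on V) \<subseteq>
      \<Union> {{g \<in> schwartz_space. schwartz_seminorm k bs (\<lambda>x. g x - f x) < e} | f k bs e.
        f \<in> schwartz_space \<and> bs \<in> lists Basis \<and> 0 < e}"
      unfolding schwartz_topology_def topology_generated_by_topspace .
  qed
  then show ?thesis
    unfolding schwartz_topology_on_def[of U] continuous_map_in_subtopology
    using maps by (auto simp: topspace_schwartz_topology_on)
qed

section \<open>Flatness of Schwartz functions at points off the open set\<close>

lemma abs_le_if_zero_and_derivative_bound:
  fixes f f' :: "real \<Rightarrow> real"
  assumes "f e = 0" and "\<And>z. (f has_real_derivative f' z) (at z)"
    and "\<And>z. \<bar>z - e\<bar> \<le> \<bar>y - e\<bar> \<Longrightarrow> \<bar>f' z\<bar> \<le> B"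
  shows "\<bar>f y\<bar> \<le> B * \<bar>y - e\<bar>"
proof -
  have "norm (f y - f e) \<le> B * norm (y - e)"
    by (rule field_differentiable_bound[where S = "cball e \<bar>y - e\<bar>" and f' = f'])
       (use assms in \<open>auto simp: dist_real_def abs_minus_commute intro: has_field_derivative_at_within\<close>)
  then show ?thesis
    using assms(1) by simp
qed

text \<open>The derivatives of orders \<open>k\<close> and \<open>k + 1\<close> both vanish at
  \<open>e\<close>, so a global bound for order \<open>k + 2\<close> can be integrated twice from
  \<open>e\<close>. The constant \<open>M\<close> is independent of \<open>e\<close>: later,
  different points \<open>y\<close> are compared with endpoints of different intervals.\<close>

lemma schwartz_quadratic_bound_off:
  fixes s :: "real \<Rightarrow> real"
  assumes s: "s \<in> schwartz_space_on V"
  obtains M where "M \<ge> 0" "\<And>e y. e \<notin> V \<Longrightarrow> \<bar>iter_partial (replicate k 1) s y\<bar> \<le> M * \<bar>y - e\<bar>\<^sup>2"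
proof -
  have S: "s \<in> schwartz_space" and
    zero: "\<And>k x. x \<notin> V \<Longrightarrow> iter_partial (replicate k 1) s x = 0"
    using s by (auto simp: schwartz_space_on_real_iff)
  have der: "(iter_partial (replicate k 1) s has_real_derivative
      iter_partial (replicate (Suc k) 1) s z) (at z)" for k z
    using S by (intro smooth_has_iter_partial_derivative[of UNIV]) (auto simp: schwartz_space_real_iff)
  \<comment> \<open>Weight exponent 0 turns the Schwartz seminorm into a plain supremum
    bound.\<close>
  obtain M where M: "\<And>x. \<bar>iter_partial (replicate (Suc (Suc k)) 1) s x\<bar> \<le> M"
    using schwartz_seminorm_upper[OF S, of _ 0 "Suc (Suc k)"] by auto
  have "M \<ge> 0"
    using M[of 0] by linarith
  have "\<bar>iter_partial (replicate k 1) s y\<bar> \<le> M * \<bar>y - e\<bar>\<^sup>2" if e: "e \<notin> V" for e y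
  proof -
    have 1: "\<bar>iter_partial (replicate (Suc k) 1) s z\<bar> \<le> M * \<bar>z - e\<bar>" for z
      by (rule abs_le_if_zero_and_derivative_bound[OF zero[OF e] der M])
    have "\<bar>iter_partial (replicate k 1) s y\<bar> \<le> M * \<bar>y - e\<bar> * \<bar>y - e\<bar>"
      by (rule abs_le_if_zero_and_derivative_bound[OF zero[OF e] der])
         (use 1 \<open>M \<ge> 0\<close> in \<open>meson mult_left_mono order_trans\<close>)
    then show ?thesis
      by (simp add: power2_eq_square)
  qed
  with \<open>M \<ge> 0\<close> show ?thesis
    using that by blast
qed

section \<open>The piecewise affine diffeomorphism\<close>

text \<open>Index 0 is left unconstrained because \<open>interval_union\<close> starts at index
  1.\<close>

definition unit_lengths :: "(nat \<Rightarrow> real) \<Rightarrow> bool" where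
  "unit_lengths a \<longleftrightarrow> (\<forall>n\<ge>1. a n \<in> {0<..1})"

lemma unit_lengthsD: "unit_lengths a \<Longrightarrow> n \<ge> 1 \<Longrightarrow> a n \<in> {0<..1}"
  by (simp add: unit_lengths_def)

text \<open>Since the interval lengths are at most 1, the interval containing \<open>x\<close> is determined by \<open>\<lfloor>x\<rfloor>\<close>.\<close>

definition slope :: "(nat \<Rightarrow> real) \<Rightarrow> (nat \<Rightarrow> real) \<Rightarrow> real \<Rightarrow> real" where
  "slope a b x = b (nat \<lfloor>x\<rfloor>) / a (nat \<lfloor>x\<rfloor>)"

definition rescale :: "(nat \<Rightarrow> real) \<Rightarrow> (nat \<Rightarrow> real) \<Rightarrow> real \<Rightarrow> real" where
  "rescale a b x = of_int \<lfloor>x\<rfloor> + (x - of_int \<lfloor>x\<rfloor>) * slope a b x"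

lemma open_interval_union: "open (interval_union a)"
  by (auto simp: interval_union_def)

lemma interval_unionE:
  assumes "x \<in> interval_union a"
  obtains n where "n \<ge> 1" "real n < x" "x < real n + a n"
  using assms by (auto simp: interval_union_def)

lemma interval_unionI: "n \<ge> 1 \<Longrightarrow> real n < x \<Longrightarrow> x < real n + a n \<Longrightarrow> x \<in> interval_union a"
  by (auto simp: interval_union_def)

lemma floor_in_unit_interval: "real n < x \<Longrightarrow> x < real n + 1 \<Longrightarrow> \<lfloor>x\<rfloor> = int n"
  by linarith

lemma rescale_eq:
  assumes "real n < x" "x < real n + a n" "a n \<le> 1"
  shows "slope a b x = b n / a n" "rescale a b x = real n + (x - real n) * (b n / a n)"
  using floor_in_unit_interval[of n x] assms by (simp_all add: slope_def rescale_def)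

text \<open>Lengths at most 1 keep an endpoint of the \<open>n\<close>-th interval out of every
  interval with another index, and openness keeps it out of its own. For \<open>a n = 1\<close> the
  right endpoint is the left endpoint of the next interval, again excluded. These are the points at
  which flatness is exploited.\<close>

lemma endpoints_notin_interval_union:
  assumes a: "unit_lengths a" and n: "n \<ge> 1"
  shows "real n \<notin> interval_union a" "real n + a n \<notin> interval_union a"
proof -
  have *: "x \<notin> interval_union a" if "x = real n \<or> x = real n + a n" for x
  proof
    assume "x \<in> interval_union a"
    then obtain j where j: "j \<ge> 1" "real j < x" "x < real j + a j"
      by (rule interval_unionE)
    have "a n \<le> 1" "a j \<le> 1" "0 < a n"
      using unit_lengthsD[OF a n] unit_lengthsD[OF a j(1)] by auto
    with j that have "real n < real j + 1" "real j < real n + 1"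
      by auto
    then have "n = j"
      by linarith
    with j that show False
      by auto
  qed
  then show "real n \<notin> interval_union a" "real n + a n \<notin> interval_union a"
    by auto
qed

lemma rescale_in_interval:
  assumes "real n < x" "x < real n + a n" "0 < a n" "a n \<le> 1" "0 < b n"
  shows "real n < rescale a b x" "rescale a b x < real n + b n"
proof -
  show "real n < rescale a b x"
    using assms by (simp add: rescale_eq)
  have "(x - real n) * b n < a n * b n"
    using assms by (intro mult_strict_right_mono) auto
  then show "rescale a b x < real n + b n"
    using assms by (simp add: rescale_eq field_simps)
qed

lemma rescale_mem:
  assumes "unit_lengths a" "unit_lengths b"
    and "x \<in> interval_union a"
  shows "rescale a b x \<in> interval_union b"
  using assms(3)
proof (rule interval_unionE)
  fix n assume n: "n \<ge> 1" "real n < x" "x < real n + a n"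
  then show ?thesis
    using rescale_in_interval[of n x a b] unit_lengthsD[OF assms(1) n(1)]
      unit_lengthsD[OF assms(2) n(1)]
    by (auto intro: interval_unionI)
qed

lemma rescale_rescale:
  assumes "unit_lengths a" "unit_lengths b"
    and "x \<in> interval_union a"
  shows "rescale b a (rescale a b x) = x"
  using assms(3)
proof (rule interval_unionE)
  fix n assume n: "n \<ge> 1" "real n < x" "x < real n + a n"
  have ab: "0 < a n" "a n \<le> 1" "0 < b n" "b n \<le> 1"
    using unit_lengthsD[OF assms(1) n(1)] unit_lengthsD[OF assms(2) n(1)] by auto
  have "rescale b a (rescale a b x) = real n + (rescale a b x - real n) * (a n / b n)"
    using rescale_in_interval[of n x a b, OF n(2,3) ab(1-3)] ab by (intro rescale_eq) auto
  also have "\<dots> = x"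
    using ab n by (simp add: rescale_eq)
  finally show ?thesis .
qed

lemma slope_has_derivative_zero:
  assumes "unit_lengths a" "x \<in> interval_union a"
  shows "(slope a b has_real_derivative 0) (at x)"
  using assms(2)
proof (rule interval_unionE)
  fix n assume n: "n \<ge> 1" "real n < x" "x < real n + a n"
  show ?thesis
    by (rule has_real_derivative_cong_open[where U = "{real n<..<real n + a n}" and g = "\<lambda>_. b n / a n"])
       (use n unit_lengthsD[OF assms(1) n(1)] in \<open>auto simp: rescale_eq\<close>)
qed

lemma rescale_has_derivative_slope:
  assumes "unit_lengths a" "x \<in> interval_union a"
  shows "(rescale a b has_real_derivative slope a b x) (at x)"
  using assms(2)
proof (rule interval_unionE)
  fix n assume n: "n \<ge> 1" "real n < x" "x < real n + a n"
  show ?thesis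
    by (rule has_real_derivative_cong_open[where U = "{real n<..<real n + a n}"
          and g = "\<lambda>x. real n + (x - real n) * (b n / a n)"])
       (use n unit_lengthsD[OF assms(1) n(1)] in \<open>auto simp: rescale_eq intro!: derivative_eq_intros\<close>)
qed

lemma smooth_on_rescale:
  assumes "unit_lengths a"
  shows "smooth_on (interval_union a) (rescale a b)"
proof (rule smooth_on_if_sequence[where F = "\<lambda>k. if k = 0 then rescale a b
      else if k = 1 then slope a b else (\<lambda>_. 0)", OF open_interval_union])
qed (auto simp: rescale_has_derivative_slope[OF assms] slope_has_derivative_zero[OF assms])

lemma diffeomorphism_rescale:
  assumes a: "unit_lengths a" and b: "unit_lengths b"
  shows "diffeomorphism (interval_union a) (interval_union b) (rescale a b)"
proof -
  have bij: "bij_betw (rescale a b) (interval_union a) (interval_union b)"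
    by (rule bij_betw_byWitness[where f' = "rescale b a"])
       (use rescale_rescale[OF a b] rescale_rescale[OF b a] rescale_mem[OF a b] rescale_mem[OF b a]
         in auto)
  have inv: "inv_into (interval_union a) (rescale a b) y = rescale b a y"
    if "y \<in> interval_union b" for y
    using that bij rescale_rescale[OF b a] rescale_mem[OF b a]
    by (intro inv_into_f_eq) (auto simp: bij_betw_def)
  \<comment> \<open>The inverse is known to equal \<open>rescale b a\<close> only on the target set,
    so the derivative sequence of \<open>rescale b a\<close> is used there as the candidate for
    it.\<close>
  have "smooth_on (interval_union b) (inv_into (interval_union a) (rescale a b))"
  proof (rule smooth_on_if_sequence[where F = "\<lambda>k. iter_partial (replicate k 1) (rescale b a)",
        OF open_interval_union])
    show "(iter_partial (replicate k 1) (rescale b a) has_real_derivative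
        iter_partial (replicate (Suc k) 1) (rescale b a) x) (at x)"
      if "x \<in> interval_union b" for k x
      by (intro smooth_has_iter_partial_derivative[OF smooth_on_rescale that] b)
  qed (simp add: inv)
  then show ?thesis
    using bij smooth_on_rescale[OF a] by (simp add: diffeomorphism_def)
qed

section \<open>Pulling back Schwartz functions\<close>

text \<open>Going from \<open>y\<close> to the outside point \<open>x\<close> one meets an endpoint
  of the interval containing \<open>y\<close>. The corresponding endpoint \<open>e\<close> of the
  target interval is off \<open>interval_union b\<close>, and its distance from
  \<open>rescale a b y\<close> is at most the slope times \<open>\<bar>y - x\<bar>\<close>. Squaring
  this in the quadratic bound produces the square of the slope.\<close>

lemma pullback_rescale_near_zero:
  fixes s :: "real \<Rightarrow> real"
  assumes a: "unit_lengths a" and b: "unit_lengths b"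
    and n: "n \<ge> 1" "real n < y" "y < real n + a n"
    and x: "x \<notin> interval_union a"
    and M: "M \<ge> 0" "\<And>e y. e \<notin> interval_union b \<Longrightarrow> \<bar>s y\<bar> \<le> M * \<bar>y - e\<bar>\<^sup>2"
  shows "\<bar>s (rescale a b y)\<bar> \<le> M * (slope a b y)\<^sup>2 * \<bar>y - x\<bar>\<^sup>2"
proof -
  have ab: "0 < a n" "a n \<le> 1" "0 < b n" "b n \<le> 1"
    using unit_lengthsD[OF a n(1)] unit_lengthsD[OF b n(1)] by auto
  have "\<exists>e. e \<notin> interval_union b \<and> \<bar>rescale a b y - e\<bar> \<le> \<bar>slope a b y * (y - x)\<bar>"
  \<comment> \<open>If \<open>x\<close> lies to the left, \<open>e\<close> is the common left
    endpoint \<open>n\<close>; otherwise \<open>x\<close> is at or beyond \<open>n + a n\<close>,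
    and \<open>e\<close> is the right endpoint \<open>n + b n\<close>.\<close>
  proof (cases "x \<le> real n")
    case True
    have "\<bar>rescale a b y - real n\<bar> = slope a b y * (y - real n)"
      using n ab by (simp add: rescale_eq)
    also have "\<dots> \<le> slope a b y * (y - x)"
      using True n ab by (intro mult_left_mono) (auto simp: rescale_eq)
    finally show ?thesis
      using endpoints_notin_interval_union(1)[OF b n(1)] by (meson abs_ge_self order_trans)
  next
    case False
    then have "real n + a n \<le> x"
      using x n interval_unionI[of n x a] by force
    have "\<bar>rescale a b y - (real n + b n)\<bar> = real n + b n - rescale a b y"
      using rescale_in_interval[of n y a b, OF n(2,3) ab(1-3)] by simp
    also have "\<dots> = slope a b y * (real n + a n - y)"
      using n ab by (simp add: rescale_eq field_simps)
    also have "\<dots> \<le> slope a b y * (x - y)"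
      using \<open>real n + a n \<le> x\<close> n ab by (intro mult_left_mono) (auto simp: rescale_eq)
    also have "\<dots> \<le> \<bar>slope a b y * (y - x)\<bar>"
      using abs_ge_self[of "slope a b y * (x - y)"] by (simp add: abs_mult abs_minus_commute)
    finally show ?thesis
      using endpoints_notin_interval_union(2)[OF b n(1)] by blast
  qed
  then obtain e where e: "e \<notin> interval_union b" "\<bar>rescale a b y - e\<bar> \<le> \<bar>slope a b y * (y - x)\<bar>"
    by blast
  have "\<bar>s (rescale a b y)\<bar> \<le> M * \<bar>rescale a b y - e\<bar>\<^sup>2"
    by (rule M(2)[OF e(1)])
  also have "\<dots> \<le> M * \<bar>slope a b y * (y - x)\<bar>\<^sup>2"
    by (intro mult_left_mono power_mono e M) auto
  finally show ?thesis
    by (simp add: power_mult_distrib)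
qed

text \<open>Taking \<open>y = x\<close> in the bound forces \<open>f x = 0\<close>, and then the
  difference quotient is at most \<open>K * \<bar>y - x\<bar>\<close>.\<close>

lemma has_real_derivative_zero_if_quadratic:
  fixes f :: "real \<Rightarrow> real"
  assumes "d > 0" "\<And>y. \<bar>y - x\<bar> < d \<Longrightarrow> \<bar>f y\<bar> \<le> K * \<bar>y - x\<bar>\<^sup>2"
  shows "(f has_real_derivative 0) (at x)"
proof -
  have "f x = 0"
    using assms(2)[of x] assms(1) by simp
  have "((\<lambda>y. (f y - f x) / (y - x)) \<longlongrightarrow> 0) (at x)"
  proof (rule Lim_null_comparison)
    show "\<forall>\<^sub>F y in at x. norm ((f y - f x) / (y - x)) \<le> K * \<bar>y - x\<bar>"
      unfolding eventually_at
    proof (intro exI[of _ d] conjI ballI impI assms)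
      fix y assume "y \<noteq> x \<and> dist y x < d"
      then have "\<bar>f y\<bar> \<le> K * \<bar>y - x\<bar>\<^sup>2" "\<bar>y - x\<bar> > 0"
        using assms(2)[of y] by (auto simp: dist_real_def)
      then show "norm ((f y - f x) / (y - x)) \<le> K * \<bar>y - x\<bar>"
        by (simp add: \<open>f x = 0\<close> abs_divide field_simps power2_eq_square)
    qed
    have "((\<lambda>y. K * \<bar>y - x\<bar>) \<longlongrightarrow> K * \<bar>x - x\<bar>) (at x)"
      by (intro tendsto_intros)
    then show "((\<lambda>y. K * \<bar>y - x\<bar>) \<longlongrightarrow> 0) (at x)"
      by simp
  qed
  then show ?thesis
    by (simp add: has_field_derivative_iff)
qed

text \<open>Both \<open>y\<close> and its image lie between \<open>n\<close> and
  \<open>n + 1\<close>, so either can replace \<open>n\<close> in the growth bound, and their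
  weights differ by a factor of at most 2. The bound in \<open>y\<close> serves differentiability at
  outside points; the one in \<open>rescale a b y\<close> serves the seminorm estimates.\<close>

lemma slope_power_bound:
  assumes a: "unit_lengths a" and b: "unit_lengths b"
    and C: "C > 0" "\<forall>n\<ge>1. b n / a n \<le> C * real n ^ q"
    and y: "y \<in> interval_union a"
  shows "slope a b y > 0" "1 + \<bar>y\<bar> \<le> 2 * (1 + \<bar>rescale a b y\<bar>)"
    "slope a b y ^ k \<le> C ^ k * (1 + \<bar>y\<bar>) ^ (q * k)"
    "slope a b y ^ k \<le> C ^ k * (1 + \<bar>rescale a b y\<bar>) ^ (q * k)"
proof -
  obtain n where n: "n \<ge> 1" "real n < y" "y < real n + a n"
    using y by (rule interval_unionE)
  have ab: "0 < a n" "a n \<le> 1" "0 < b n" "b n \<le> 1"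
    using unit_lengthsD[OF a n(1)] unit_lengthsD[OF b n(1)] by auto
  show "slope a b y > 0"
    using n ab by (simp add: rescale_eq)
  note r = rescale_in_interval[of n y a b, OF n(2,3) ab(1-3)]
  show "1 + \<bar>y\<bar> \<le> 2 * (1 + \<bar>rescale a b y\<bar>)"
  proof -
    have "\<bar>y\<bar> = y" "\<bar>rescale a b y\<bar> = rescale a b y"
      using r n by auto
    then show ?thesis
      using r n ab by simp
  qed
  have *: "slope a b y ^ k \<le> C ^ k * (1 + \<bar>z\<bar>) ^ (q * k)" if "real n < z" for z
  proof -
    have "slope a b y ^ k \<le> (C * real n ^ q) ^ k"
      using n ab C(2) n(1) by (intro power_mono) (auto simp: rescale_eq)
    also have "\<dots> = C ^ k * real n ^ (q * k)"
      by (simp add: power_mult_distrib power_mult)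
    also have "\<dots> \<le> C ^ k * (1 + \<bar>z\<bar>) ^ (q * k)"
      using that C(1) by (intro mult_left_mono power_mono) auto
    finally show ?thesis .
  qed
  show "slope a b y ^ k \<le> C ^ k * (1 + \<bar>y\<bar>) ^ (q * k)"
    "slope a b y ^ k \<le> C ^ k * (1 + \<bar>rescale a b y\<bar>) ^ (q * k)"
    using * n r by auto
qed

text \<open>Inside the intervals the slope is locally constant, so each differentiation merely adds
  one factor of it. At outside points, endpoints included, every candidate derivative is
  quadratically small and hence has derivative 0, which is the next candidate's value there.\<close>

lemma pullback_rescale_derivatives:
  fixes s :: "real \<Rightarrow> real"
  assumes a: "unit_lengths a" and b: "unit_lengths b"
    and C: "C > 0" "\<forall>n\<ge>1. b n / a n \<le> C * real n ^ q"
    and s: "s \<in> schwartz_space_on (interval_union b)"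
  defines "T \<equiv> pullback_on (interval_union a) (rescale a b) s"
  shows "iter_partial (replicate k 1) T x = (if x \<in> interval_union a then
      slope a b x ^ k * iter_partial (replicate k 1) s (rescale a b x) else 0)"
    and "smooth_on UNIV T"
proof -
  let ?U = "interval_union a"
  define F where "F = (\<lambda>k x. if x \<in> ?U then
      slope a b x ^ k * iter_partial (replicate k 1) s (rescale a b x) else 0)"
  have sm: "smooth_on UNIV s"
    using s by (simp add: schwartz_space_on_real_iff schwartz_space_real_iff)
  have F0: "T x = F 0 x" for x
    by (simp add: T_def F_def pullback_on_def)
  have FS: "(F k has_real_derivative F (Suc k) x) (at x)" for k x
  proof (cases "x \<in> ?U")
    case True
    have s': "(iter_partial (replicate k 1) s has_real_derivative
        iter_partial (replicate (Suc k) 1) s (rescale a b x)) (at (rescale a b x))"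
      by (rule smooth_has_iter_partial_derivative[OF sm UNIV_I])
    have slope_pow: "((\<lambda>y. slope a b y ^ k) has_real_derivative 0) (at x)"
      using DERIV_power[OF slope_has_derivative_zero[OF a True], where n = k] by simp
    have "((\<lambda>y. slope a b y ^ k * iter_partial (replicate k 1) s (rescale a b y))
        has_real_derivative F (Suc k) x) (at x)"
      using DERIV_mult[OF slope_pow DERIV_chain2[OF s' rescale_has_derivative_slope[OF a True]]] True
      by (simp add: F_def mult_ac)
    then show ?thesis
      by (rule has_real_derivative_cong_open[OF open_interval_union True, rotated])
         (simp add: F_def)
  next
    case False
    obtain M where M: "M \<ge> 0"
      "\<And>e y. e \<notin> interval_union b \<Longrightarrow> \<bar>iter_partial (replicate k 1) s y\<bar> \<le> M * \<bar>y - e\<bar>\<^sup>2"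
      using schwartz_quadratic_bound_off[OF s, of k] by metis
    \<comment> \<open>The derivative formula contributes the slope to the power \<open>k\<close> and
      the quadratic bound two more factors, hence \<open>k + 2\<close>. For
      \<open>\<bar>y - x\<bar> < 1\<close> the weight \<open>1 + \<bar>y\<bar>\<close> is at most
      \<open>2 + \<bar>x\<bar>\<close>, which frees the constant from \<open>y\<close>.\<close>
    define K where "K = C ^ (k + 2) * (2 + \<bar>x\<bar>) ^ (q * (k + 2)) * M"
    have "K \<ge> 0"
      using C(1) M(1) by (simp add: K_def)
    have "\<bar>F k y\<bar> \<le> K * \<bar>y - x\<bar>\<^sup>2" if y: "\<bar>y - x\<bar> < 1" for y
    proof (cases "y \<in> ?U")
      case True
      then obtain n where n: "n \<ge> 1" "real n < y" "y < real n + a n"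
        by (rule interval_unionE)
      note sl = slope_power_bound[OF a b C True]
      have "\<bar>F k y\<bar> = slope a b y ^ k * \<bar>iter_partial (replicate k 1) s (rescale a b y)\<bar>"
        using True sl(1) by (simp add: F_def abs_mult)
      also have "\<dots> \<le> slope a b y ^ k * (M * (slope a b y)\<^sup>2 * \<bar>y - x\<bar>\<^sup>2)"
        using sl(1) by (intro mult_left_mono pullback_rescale_near_zero[OF a b n False M]) auto
      also have "\<dots> = slope a b y ^ (k + 2) * (M * \<bar>y - x\<bar>\<^sup>2)"
        by (simp only: power_add mult_ac)
      also have "\<dots> \<le> (C ^ (k + 2) * (1 + \<bar>y\<bar>) ^ (q * (k + 2))) * (M * \<bar>y - x\<bar>\<^sup>2)"
        using sl(3)[of "k + 2"] M(1) by (intro mult_right_mono) auto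
      also have "\<dots> \<le> (C ^ (k + 2) * (2 + \<bar>x\<bar>) ^ (q * (k + 2))) * (M * \<bar>y - x\<bar>\<^sup>2)"
        using y M(1) C(1) by (intro mult_right_mono mult_left_mono power_mono) auto
      finally show ?thesis
        by (simp add: K_def mult_ac)
    qed (use \<open>K \<ge> 0\<close> in \<open>simp add: F_def\<close>)
    then have "(F k has_real_derivative 0) (at x)"
      by (intro has_real_derivative_zero_if_quadratic[of 1]) auto
    then show ?thesis
      using False by (simp add: F_def)
  qed
  have "iter_partial (replicate k 1) T x = F k x"
    by (rule iter_partial_eq_sequence[where U = UNIV]) (use F0 FS in auto)
  then show "iter_partial (replicate k 1) T x = (if x \<in> ?U then
      slope a b x ^ k * iter_partial (replicate k 1) s (rescale a b x) else 0)"
    by (simp add: F_def)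
  show "smooth_on UNIV T"
    by (rule smooth_on_if_sequence[where F = F]) (use F0 FS in auto)
qed

text \<open>The slope factor grows like a polynomial of degree \<open>q * k\<close>, which is paid
  for by raising the weight exponent from \<open>m\<close> to \<open>m + q * k\<close>; the
  derivative order stays \<open>k\<close>. The factor \<open>2 ^ m\<close> comes from passing from
  the weight at \<open>x\<close> to the weight at its image.\<close>

lemma pullback_rescale_seminorm_bound:
  fixes s :: "real \<Rightarrow> real"
  assumes a: "unit_lengths a" and b: "unit_lengths b"
    and C: "C > 0" "\<forall>n\<ge>1. b n / a n \<le> C * real n ^ q"
    and s: "s \<in> schwartz_space_on (interval_union b)"
  defines "T \<equiv> pullback_on (interval_union a) (rescale a b) s"
  shows "(1 + \<bar>x\<bar>) ^ m * \<bar>iter_partial (replicate k 1) T x\<bar> \<le>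
    2 ^ m * C ^ k * schwartz_seminorm (m + q * k) (replicate k 1) s"
proof -
  have S: "s \<in> schwartz_space"
    using s by (simp add: schwartz_space_on_real_iff)
  note D = pullback_rescale_derivatives(1)[OF a b C s, folded T_def, where k = k and x = x]
  note up = schwartz_seminorm_upper[OF S, of _ "m + q * k" k]
  show ?thesis
  proof (cases "x \<in> interval_union a")
    case True
    note sl = slope_power_bound[OF a b C True]
    let ?y = "rescale a b x"
    have "(1 + \<bar>x\<bar>) ^ m * \<bar>iter_partial (replicate k 1) T x\<bar> =
        (1 + \<bar>x\<bar>) ^ m * slope a b x ^ k * \<bar>iter_partial (replicate k 1) s ?y\<bar>"
      using True sl(1) by (simp add: D abs_mult)
    also have "\<dots> \<le> (2 * (1 + \<bar>?y\<bar>)) ^ m * (C ^ k * (1 + \<bar>?y\<bar>) ^ (q * k)) *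
        \<bar>iter_partial (replicate k 1) s ?y\<bar>"
      using sl C(1) by (intro mult_right_mono mult_mono power_mono) (auto simp: less_imp_le)
    also have "\<dots> = 2 ^ m * C ^ k *
        ((1 + \<bar>?y\<bar>) ^ (m + q * k) * \<bar>iter_partial (replicate k 1) s ?y\<bar>)"
      by (simp only: power_add power_mult_distrib mult_ac)
    also have "\<dots> \<le> 2 ^ m * C ^ k * schwartz_seminorm (m + q * k) (replicate k 1) s"
      using C(1) by (intro mult_left_mono up) auto
    finally show ?thesis .
  next
    case False
    \<comment> \<open>Off the intervals the left side is 0, so only the sign of the right side
      matters; evaluating the upper bound at the point 0 gives it.\<close>
    have "0 \<le> schwartz_seminorm (m + q * k) (replicate k 1) s"
      by (rule order_trans[OF _ up[of 0]]) simp
    then show ?thesis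
      using False C(1) by (simp add: D)
  qed
qed

lemma pullback_rescale_mem:
  fixes s :: "real \<Rightarrow> real"
  assumes a: "unit_lengths a" and b: "unit_lengths b"
    and C: "C > 0" "\<forall>n\<ge>1. b n / a n \<le> C * real n ^ q"
    and s: "s \<in> schwartz_space_on (interval_union b)"
  shows "pullback_on (interval_union a) (rescale a b) s \<in> schwartz_space_on (interval_union a)"
proof -
  let ?T = "pullback_on (interval_union a) (rescale a b) s"
  have "\<exists>B. \<forall>x. (1 + \<bar>x\<bar>) ^ m * \<bar>iter_partial (replicate k 1) ?T x\<bar> \<le> B" for m k
    using pullback_rescale_seminorm_bound[OF a b C s] by blast
  then show ?thesis
    using pullback_rescale_derivatives[OF a b C s]
    by (simp add: schwartz_space_on_real_iff schwartz_space_real_iff)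
qed

lemma continuous_map_pullback_rescale:
  assumes a: "unit_lengths a" and b: "unit_lengths b"
    and C: "C > 0" "\<forall>n\<ge>1. b n / a n \<le> C * real n ^ q"
  shows "continuous_map (schwartz_topology_on (interval_union b))
    (schwartz_topology_on (interval_union a)) (pullback_on (interval_union a) (rescale a b))"
proof (rule continuous_map_schwartz)
  let ?V = "interval_union b" and ?T = "pullback_on (interval_union a) (rescale a b)"
  fix m k
  have "schwartz_seminorm m (replicate k 1) (\<lambda>x. ?T f x - ?T g x) \<le>
      2 ^ m * C ^ k * schwartz_seminorm (m + q * k) (replicate k 1) (\<lambda>x. f x - g x)"
    if f: "f \<in> schwartz_space_on ?V" and g: "g \<in> schwartz_space_on ?V" for f g
  proof -
    \<comment> \<open>The pullback of a difference is the difference of the pullbacks, so the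
      Lipschitz estimate reduces to the seminorm bound for the single function
      \<open>f - g\<close>.\<close>
    have fg: "(\<lambda>x. f x - g x) \<in> schwartz_space_on ?V"
    proof -
      have "f \<in> schwartz_space" "g \<in> schwartz_space" "smooth_on UNIV f" "smooth_on UNIV g"
        using f g by (auto simp: schwartz_space_on_real_iff schwartz_space_real_iff)
      then show ?thesis
        using f g schwartz_space_diff smooth_iter_partial_linear(1)[of f g _ 1 "-1"]
        by (auto simp: schwartz_space_on_real_iff)
    qed
    have "(\<lambda>x. ?T f x - ?T g x) = ?T (\<lambda>x. f x - g x)"
      by (auto simp: pullback_on_def)
    then show ?thesis
      using pullback_rescale_seminorm_bound[OF a b C fg] by (auto intro: schwartz_seminorm_least)
  qed
  then show "\<exists>C>0. \<exists>m' k'. \<forall>f\<in>schwartz_space_on ?V. \<forall>g\<in>schwartz_space_on ?V.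
      schwartz_seminorm m (replicate k 1) (\<lambda>x. ?T f x - ?T g x) \<le>
        C * schwartz_seminorm m' (replicate k' 1) (\<lambda>x. f x - g x)"
    using C(1) by (intro exI[of _ "2 ^ m * C ^ k"] conjI exI[of _ "m + q * k"] exI[of _ k]) auto
qed (rule pullback_rescale_mem[OF a b C])

lemma pullback_rescale_inverse:
  assumes a: "unit_lengths a" and b: "unit_lengths b"
    and s: "s \<in> schwartz_space_on (interval_union b)"
  shows "pullback_on (interval_union b) (rescale b a)
    (pullback_on (interval_union a) (rescale a b) s) = s"
proof
  fix x
  \<comment> \<open>The order 0 case of the vanishing condition: the extension by zero in
    \<open>pullback_on\<close> agrees with \<open>s\<close> off its open set.\<close>
  have "x \<notin> interval_union b \<Longrightarrow> s x = 0"
    using s unfolding schwartz_space_on_real_iff by (metis iter_partial.simps(1) replicate_0)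
  then show "pullback_on (interval_union b) (rescale b a)
      (pullback_on (interval_union a) (rescale a b) s) x = s x"
    using rescale_rescale[OF b a] rescale_mem[OF b a] by (auto simp: pullback_on_def)
qed

section \<open>Polynomial growth of the length ratios, and the conclusion\<close>

lemma polynomial_ratio_bound:
  fixes a b :: "nat \<Rightarrow> real"
  assumes a: "unit_lengths a" and b: "unit_lengths b"
    and c: "c > 0" "\<forall>n. real n > n\<^sub>0 \<longrightarrow> a n \<ge> c * real n powr (- p)"
  shows "\<exists>C>0. \<exists>q. \<forall>n\<ge>1. b n / a n \<le> C * real n ^ q"
proof -
  \<comment> \<open>No lower bound on \<open>a\<close> beyond positivity is available for
    \<open>n\<close> up to \<open>N\<close>; these are finitely many indices. The real exponent
    \<open>p\<close> is rounded up to a natural power \<open>q\<close>.\<close>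
  define N where "N = nat \<lceil>n\<^sub>0\<rceil>"
  define q where "q = nat \<lceil>p\<rceil>"
  \<comment> \<open>The sum dominates each of the finitely many initial ratios, and
    \<open>1 / c\<close> handles the tail; adding them gives one constant for all indices.\<close>
  define C where "C = 1 / c + (\<Sum>n=1..N. b n / a n)"
  have pos: "0 \<le> (\<Sum>n=1..N. b n / a n)"
    using unit_lengthsD[OF a] unit_lengthsD[OF b]
    by (intro sum_nonneg divide_nonneg_nonneg) (auto simp: less_imp_le)
  then have "C > 0"
    using c(1) by (simp add: C_def add_pos_nonneg)
  have "b n / a n \<le> C * real n ^ q" if n: "n \<ge> 1" for n
  proof (cases "n \<le> N")
    case True
    have "b n / a n \<le> (\<Sum>n=1..N. b n / a n)"
      using True n unit_lengthsD[OF a] unit_lengthsD[OF b]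
      by (intro member_le_sum) (auto simp: less_imp_le)
    also have "\<dots> \<le> C * 1"
      using c(1) by (simp add: C_def)
    also have "\<dots> \<le> C * real n ^ q"
      using n \<open>C > 0\<close> by (intro mult_left_mono) auto
    finally show ?thesis .
  next
    case False
    then have "real n > n\<^sub>0"
      unfolding N_def by linarith
    \<comment> \<open>The numerator is at most 1, so in the tail only the lower bound on
      \<open>a\<close> is needed.\<close>
    have "b n / a n \<le> 1 / (c * real n powr (- p))"
      using c(2) \<open>real n > n\<^sub>0\<close> unit_lengthsD[OF a n] unit_lengthsD[OF b n] c(1) n
      by (intro frac_le) auto
    also have "\<dots> = real n powr p / c"
      by (simp add: powr_minus field_simps)
    also have "real n powr p \<le> real n powr real q"
      using n by (intro powr_mono) (auto simp: q_def real_nat_ceiling_ge)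
    also have "real n powr real q / c = (1 / c) * real n ^ q"
      using n by (simp add: powr_realpow)
    also have "\<dots> \<le> C * real n ^ q"
      using pos by (intro mult_right_mono) (auto simp: C_def)
    finally show ?thesis
      using c(1) by (simp add: divide_right_mono)
  qed
  with \<open>C > 0\<close> show ?thesis
    by blast
qed

theorem mainTheorem8:
  fixes a b :: "nat \<Rightarrow> real"
  assumes "\<And>n. n \<ge> 1 \<Longrightarrow> a n \<in> {0<..1}"
    and "\<And>n. n \<ge> 1 \<Longrightarrow> b n \<in> {0<..1}"
    and "\<exists>c p n\<^sub>0 :: real. c > 0 \<and> p > 0 \<and> n\<^sub>0 > 0 \<and>
           (\<forall>n::nat. real n > n\<^sub>0 \<longrightarrow>
              a n \<ge> c * real n powr (- p) \<and> b n \<ge> c * real n powr (- p))"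
  shows "schwartz_equivalent (interval_union a) (interval_union b)"
proof -
  let ?U = "interval_union a" and ?V = "interval_union b"
  have a: "unit_lengths a" and b: "unit_lengths b"
    using assms(1,2) by (simp_all add: unit_lengths_def)
  obtain c p n\<^sub>0 where c: "c > 0" and ca: "\<forall>n. real n > n\<^sub>0 \<longrightarrow> a n \<ge> c * real n powr (- p)"
    and cb: "\<forall>n. real n > n\<^sub>0 \<longrightarrow> b n \<ge> c * real n powr (- p)"
    using assms(3) by blast
  obtain C q where C: "C > 0" "\<forall>n\<ge>1. b n / a n \<le> C * real n ^ q"
    using polynomial_ratio_bound[OF a b c ca] by blast
  \<comment> \<open>The inverse map has the reciprocal slopes, so its continuity rests on the lower
    bound for \<open>b\<close>, just as the first direction rests on the one for
    \<open>a\<close>.\<close>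
  obtain C' q' where C': "C' > 0" "\<forall>n\<ge>1. a n / b n \<le> C' * real n ^ q'"
    using polynomial_ratio_bound[OF b a c cb] by blast
  have "homeomorphic_maps (schwartz_topology_on ?V) (schwartz_topology_on ?U)
      (pullback_on ?U (rescale a b)) (pullback_on ?V (rescale b a))"
    unfolding homeomorphic_maps_def topspace_schwartz_topology_on
    using continuous_map_pullback_rescale[OF a b C] continuous_map_pullback_rescale[OF b a C']
      pullback_rescale_inverse[OF a b] pullback_rescale_inverse[OF b a] by blast
  then have "schwartz_isomorphism ?V ?U (pullback_on ?U (rescale a b))"
    unfolding schwartz_isomorphism_def
    by (auto simp: homeomorphic_map_maps pullback_on_def)
  then show ?thesis
    unfolding schwartz_equivalent_def
    using diffeomorphism_rescale[OF a b] open_interval_union by blast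
qed

end
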